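(* Let $t>1$ be fixed, let $(f_t,g_t)$ be a pair of relatively elementary functions of two variables which restricts to a self-dynamics over $[r,R]$ with constant $q$, and let initial values $$u:[0,\infty)\times\{0\}\to[r+q,R-q],\qquad v:\{0\}\times[0,\infty)\to[r+q,R-q]$$ with uniformly bounded $C^2$ norms be given. Consider the hyperbolic Mealy system $$u_s=f_t(v,u)-u,\qquad v_x=g_t(v,u)-v .$$ Then: (1) there exists a positive solution $u,v:[0,\infty)\times[0,\infty)\to(0,\infty)$ with the given initial values, satisfying the uniform bounds $r+q\le u(x,s),\,v(x,s)\le R-q$; (2) the solution is unique.
   Context: A relatively elementary function of two variables is, for fixed $t>1$, a function $f_t:(0,\infty)^2\to(0,\infty)$ of the form $f_t(\bar z)=\dfrac{\sum_{k=1}^m t^{\alpha_k}\bar z^{\bar a_k}}{\sum_{k=1}^l t^{\beta_k}\bar z^{\bar b_k}}$, with $\alpha_k,\beta_k\in\mathbb R$, $\bar a_k,\bar b_k\in\mathbb Q^2$, $\bar z^{\bar a}=z_1^{a^1}z_2^{a^2}$. The pair $(f_t,g_t)$ restricts to a self-dynamics over $[r,R]$ ($0<r<R$) if there is some $0<q<r$ such that for all $a>0$: $f_t(a,b)-b\ge q$ and $g_t(b,a)-b\ge q$ whenever $0<b\le r+q$; $f_t(a,b)-b\le-q$ and $g_t(b,a)-b\le-q$ whenever $b\ge R-q$; and $|f_t(a,b)-b|\le R-r$, $|g_t(b,a)-b|\le R-r$ whenever $r\le b\le R$. The constant $q$ in the claim is this one. Initial values mean the prescribed functions $u(x,0)$,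 $x\ge0$, and $v(0,s)$, $s\ge0$. *)

theory Defs
  imports "HOL-Analysis.Analysis"
begin

text \<open>The values of \<open>f\<close> outside the open positive quadrant are irrelevant.  The numbers of
  summands are at least 1, since \<open>f\<close> is a well-defined map into the positive reals.\<close>

definition relatively_elementary :: "real \<Rightarrow> (real \<Rightarrow> real \<Rightarrow> real) \<Rightarrow> bool" where
  "relatively_elementary t f \<longleftrightarrow>
     (\<exists>(m::nat) (l::nat) (\<alpha>::nat \<Rightarrow> real) (\<beta>::nat \<Rightarrow> real)
        (a::nat \<Rightarrow> rat \<times> rat) (b::nat \<Rightarrow> rat \<times> rat).
        m \<ge> 1 \<and> l \<ge> 1 \<and>
        (\<forall>z1>0. \<forall>z2>0. f z1 z2 =
           (\<Sum>k=1..m. t powr \<alpha> k * (z1 powr of_rat (fst (a k)) * z2 powr of_rat (snd (a k)))) /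
           (\<Sum>k=1..l. t powr \<beta> k * (z1 powr of_rat (fst (b k)) * z2 powr of_rat (snd (b k))))))"

text \<open>The pair restricts to a self-dynamics over \<open>[r, R]\<close>, with \<open>q\<close> as the witnessing constant.
  Note the exchanged order of the arguments of \<open>g\<close>.\<close>

definition self_dynamics ::
  "(real \<Rightarrow> real \<Rightarrow> real) \<Rightarrow> (real \<Rightarrow> real \<Rightarrow> real) \<Rightarrow> real \<Rightarrow> real \<Rightarrow> real \<Rightarrow> bool" where
  "self_dynamics f g r R q \<longleftrightarrow>
     0 < r \<and> r < R \<and> 0 < q \<and> q < r \<and>
     (\<forall>a>0.
        (\<forall>b. 0 < b \<and> b \<le> r + q \<longrightarrow> f a b - b \<ge> q \<and> g b a - b \<ge> q) \<and>
        (\<forall>b. b \<ge> R - q \<longrightarrow> f a b - b \<le> - q \<and> g b a - b \<le> - q) \<and>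
        (\<forall>b. r \<le> b \<and> b \<le> R \<longrightarrow> \<bar>f a b - b\<bar> \<le> R - r \<and> \<bar>g b a - b\<bar> \<le> R - r))"

text \<open>\<open>C\<^sup>2\<close> functions on the half-line \<open>[0, \<infinity>)\<close> (one-sided derivatives at 0) whose \<open>C\<^sup>2\<close> norm
  is finite.\<close>

definition bounded_C2 :: "(real \<Rightarrow> real) \<Rightarrow> bool" where
  "bounded_C2 h \<longleftrightarrow>
     (\<exists>h' h''.
        (\<forall>x\<ge>0. (h has_real_derivative h' x) (at x within {0..})) \<and>
        (\<forall>x\<ge>0. (h' has_real_derivative h'' x) (at x within {0..})) \<and>
        continuous_on {0..} h'' \<and>
        bounded (h ` {0..}) \<and> bounded (h' ` {0..}) \<and> bounded (h'' ` {0..}))"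

text \<open>\<open>C\<^sup>1\<close> functions on the closed quadrant: both partial derivatives exist (one-sided on the
  boundary) and are jointly continuous.\<close>

definition C1_quadrant :: "(real \<Rightarrow> real \<Rightarrow> real) \<Rightarrow> bool" where
  "C1_quadrant w \<longleftrightarrow>
     (\<exists>wx ws.
        (\<forall>x\<ge>0. \<forall>s\<ge>0.
           ((\<lambda>y. w y s) has_real_derivative wx x s) (at x within {0..}) \<and>
           ((\<lambda>\<sigma>. w x \<sigma>) has_real_derivative ws x s) (at s within {0..})) \<and>
        continuous_on ({0..} \<times> {0..}) (\<lambda>(x, s). wx x s) \<and>
        continuous_on ({0..} \<times> {0..}) (\<lambda>(x, s). ws x s))"

text \<open>Positive classical (\<open>C\<^sup>1\<close>) solutions on the closed quadrant of
  \<open>u\<^sub>s = f(v, u) - u\<close>, \<open>v\<^sub>x = g(v, u) - v\<close> with \<open>u(x, 0) = u0(x)\<close> and \<open>v(0, s) = v0(s)\<close>.\<close>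

definition positive_Mealy_solution ::
  "(real \<Rightarrow> real \<Rightarrow> real) \<Rightarrow> (real \<Rightarrow> real \<Rightarrow> real) \<Rightarrow> (real \<Rightarrow> real) \<Rightarrow> (real \<Rightarrow> real) \<Rightarrow>
   (real \<Rightarrow> real \<Rightarrow> real) \<Rightarrow> (real \<Rightarrow> real \<Rightarrow> real) \<Rightarrow> bool" where
  "positive_Mealy_solution f g u0 v0 u v \<longleftrightarrow>
     C1_quadrant u \<and> C1_quadrant v \<and>
     (\<forall>x\<ge>0. \<forall>s\<ge>0.
        u x s > 0 \<and> v x s > 0 \<and>
        ((\<lambda>\<sigma>. u x \<sigma>) has_real_derivative (f (v x s) (u x s) - u x s)) (at s within {0..}) \<and>
        ((\<lambda>y. v y s) has_real_derivative (g (v x s) (u x s) - v x s)) (at x within {0..})) \<and>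
     (\<forall>x\<ge>0. u x 0 = u0 x) \<and> (\<forall>s\<ge>0. v 0 s = v0 s)"

end

theory Submission
  imports Defs
begin

text \<open>
  Positive solutions cannot leave the square \<open>[r + q, R - q]\<^sup>2\<close>, because the right-hand sides point
  inwards at its boundary; there \<open>f\<close> and \<open>g\<close> are Lipschitz.  A weighted supremum estimate gives
  uniqueness, and the corresponding contraction gives a continuous solution of the integral
  equations, first for truncated right-hand sides.  The derivatives \<open>u\<^sub>s\<close> and \<open>v\<^sub>x\<close> are then given by
  the system.  For \<open>u\<^sub>x\<close>, note that the increment \<open>u(y, s) - u(x, s)\<close> satisfies a scalar linear
  equation in \<open>s\<close> whose inhomogeneity contains \<open>v(y, s) - v(x, s)\<close>, which is \<open>y - x\<close> times a mean of the
  known derivative \<open>v\<^sub>x\<close>; solving it explicitly exhibits the increment as \<open>y - x\<close> times a continuous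
  function.  The argument for \<open>v\<^sub>s\<close> is symmetric.
\<close>

section \<open>Means over segments and barriers\<close>

text \<open>Normalising to the fixed interval [0, 1] gives a meaning for either order of
  \<open>x\<close> and \<open>y\<close> and also for \<open>x = y\<close>, where the value is
  \<open>h x\<close>. The product \<open>s * segment_mean h 0 s\<close> is the oriented integral
  from 0 to \<open>s\<close>.\<close>

definition segment_mean :: "(real \<Rightarrow> real) \<Rightarrow> real \<Rightarrow> real \<Rightarrow> real" where
  "segment_mean h x y = integral {0..1} (\<lambda>\<theta>. h (x + \<theta> * (y - x)))"

lemma convex_segment_point:
  fixes x y :: real
  assumes "convex I" "x \<in> I" "y \<in> I" "\<theta> \<in> {0..1}"
  shows "x + \<theta> * (y - x) \<in> I"
  using convexD_alt[OF assms(1-3), of \<theta>] assms(4) by (simp add: algebra_simps)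

text \<open>Moving endpoints become mere parameters of an integral over [0, 1], so continuity of
  parameter integrals applies; convexity keeps the segment in the domain. The extra variable
  \<open>p\<close> allows means of slices of functions of several variables.\<close>

lemma continuous_on_segment_mean:
  fixes h :: "real \<Rightarrow> 'p::topological_space \<Rightarrow> real"
  assumes h: "continuous_on (I \<times> T) (\<lambda>(z, p). h z p)" and I: "convex I"
    and X: "continuous_on W X" and Y: "continuous_on W Y" and P: "continuous_on W P"
    and XI: "\<And>w. w \<in> W \<Longrightarrow> X w \<in> I" and YI: "\<And>w. w \<in> W \<Longrightarrow> Y w \<in> I"
    and PT: "\<And>w. w \<in> W \<Longrightarrow> P w \<in> T"
  shows "continuous_on W (\<lambda>w. segment_mean (\<lambda>z. h z (P w)) (X w) (Y w))"
proof -
  have cX: "continuous_on (W \<times> {0..1::real}) (\<lambda>z. X (fst z))"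
    and cY: "continuous_on (W \<times> {0..1::real}) (\<lambda>z. Y (fst z))"
    and cP: "continuous_on (W \<times> {0..1::real}) (\<lambda>z. P (fst z))"
    by (rule continuous_on_compose2[OF X] continuous_on_compose2[OF Y] continuous_on_compose2[OF P];
        auto intro: continuous_intros)+
  have "continuous_on (W \<times> {0..1})
      (\<lambda>z. (\<lambda>(z, p). h z p) (X (fst z) + snd z * (Y (fst z) - X (fst z)), P (fst z)))"
    by (rule continuous_on_compose2[OF h])
       (auto intro!: continuous_intros cX cY cP convex_segment_point[OF I] XI YI PT)
  then have "continuous_on (W \<times> cbox 0 1)
      (\<lambda>(w, \<theta>). h (X w + \<theta> * (Y w - X w)) (P w))"
    by (simp add: split_beta)
  from integral_continuous_on_param[OF this] show ?thesis
    unfolding segment_mean_def by simp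
qed

lemma continuous_on_segment_mean':
  assumes h: "continuous_on I h" and I: "convex I"
    and X: "continuous_on W X" and Y: "continuous_on W Y"
    and "\<And>w. w \<in> W \<Longrightarrow> X w \<in> I" and "\<And>w. w \<in> W \<Longrightarrow> Y w \<in> I"
  shows "continuous_on W (\<lambda>w. segment_mean h (X w) (Y w))"
proof -
  have "continuous_on (I \<times> {0::real}) (\<lambda>(z, _). h z)"
    by (auto simp: split_beta intro!: continuous_on_compose2[OF h] continuous_intros)
  from continuous_on_segment_mean[OF this I X Y, where P="\<lambda>_. 0"] assms show ?thesis
    by (auto intro: continuous_intros)
qed

text \<open>The fundamental theorem of calculus along the segment from \<open>x\<close> to
  \<open>y\<close>. The difference quotient is thereby replaced by an expression that survives
  \<open>y = x\<close>.\<close>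

lemma increment_eq_segment_mean:
  assumes I: "convex I" and x: "x \<in> I" and y: "y \<in> I"
    and H: "\<And>z. z \<in> I \<Longrightarrow> (H has_real_derivative h z) (at z within I)"
  shows "H y - H x = (y - x) * segment_mean h x y"
proof -
  have "((\<lambda>\<theta>. (y - x) * h (x + \<theta> * (y - x))) has_integral
      H (x + 1 * (y - x)) - H (x + 0 * (y - x))) {0..1}"
  proof (rule fundamental_theorem_of_calculus)
    fix \<theta> :: real assume \<theta>: "\<theta> \<in> {0..1}"
    have sub: "(\<lambda>\<theta>. x + \<theta> * (y - x)) ` {0..1} \<subseteq> I"
      using convex_segment_point[OF I x y] by auto
    have "(H has_real_derivative h (x + \<theta> * (y - x))) (at (x + \<theta> * (y - x)) within (\<lambda>\<theta>. x + \<theta> * (y - x)) ` {0..1})"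
      by (rule DERIV_subset[OF H sub]) (rule convex_segment_point[OF I x y \<theta>])
    moreover have "((\<lambda>\<theta>. x + \<theta> * (y - x)) has_real_derivative y - x) (at \<theta> within {0..1})"
      by (auto intro!: derivative_eq_intros)
    ultimately have "(H \<circ> (\<lambda>\<theta>. x + \<theta> * (y - x)) has_real_derivative h (x + \<theta> * (y - x)) * (y - x)) (at \<theta> within {0..1})"
      by (rule DERIV_image_chain)
    then show "((\<lambda>\<theta>. H (x + \<theta> * (y - x))) has_vector_derivative
        (y - x) * h (x + \<theta> * (y - x))) (at \<theta> within {0..1})"
      by (simp add: o_def has_real_derivative_iff_has_vector_derivative mult.commute)
  qed simp
  then show ?thesis
    unfolding segment_mean_def by (simp add: integral_unique flip: integral_mult_right)
qed

lemma has_real_derivative_segment_mean: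
  assumes h: "continuous_on {0..} h" and s: "0 \<le> s"
  shows "((\<lambda>s. s * segment_mean h 0 s) has_real_derivative h s) (at s within {0..})"
proof -
  have I: "((\<lambda>s. integral {0..s} h) has_real_derivative h s) (at s within {0..})" if "0 \<le> s" for s
  proof -
    \<comment> \<open>The interval extends beyond \<open>s\<close> so that its filter at
      \<open>s\<close> agrees with that of the half-line.\<close>
    have "((\<lambda>s. integral {0..s} h) has_real_derivative h s) (at s within {0..s + 1})"
      by (rule integral_has_real_derivative) (use that in \<open>auto intro: continuous_on_subset[OF h]\<close>)
    moreover have "at s within {0..s + 1} = at s within {0..}"
      by (rule at_within_nhd[of _ "{..<s + 1}"]) auto
    ultimately show ?thesis by simp
  qed
  have "integral {0..s} h = s * segment_mean h 0 s" if "0 \<le> s" for s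
    using increment_eq_segment_mean[where H="\<lambda>s. integral {0..s} h" and I="{0..}" and h=h and x=0 and y=s] I that
    by simp
  then show ?thesis
    using I[OF s] s by (auto elim!: has_field_derivative_transform_within[OF _ zero_less_one])
qed

text \<open>If \<open>y\<close> fell below \<open>c\<close>, its minimum over [0, s] would be
  attained at some \<open>m > 0\<close> with \<open>y m < c\<close>. The positive derivative there
  gives still smaller values just to the left of \<open>m\<close>.\<close>

lemma barrier_below:
  fixes y :: "real \<Rightarrow> real"
  assumes y: "\<And>s. 0 \<le> s \<Longrightarrow> (y has_real_derivative y' s) (at s within {0..})"
    and y0: "c \<le> y 0" and pos: "\<And>s. 0 \<le> s \<Longrightarrow> y s \<le> c \<Longrightarrow> 0 < y' s" and s: "0 \<le> s"
  shows "c \<le> y s"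
proof (rule ccontr)
  assume "\<not> c \<le> y s"
  have "continuous_on {0..s} y"
    by (rule DERIV_continuous_on[where D=y']) (auto intro: DERIV_subset[OF y])
  then obtain m where m: "m \<in> {0..s}" "\<And>z. z \<in> {0..s} \<Longrightarrow> y m \<le> y z"
    using continuous_attains_inf[of "{0..s}" y] s by auto
  then have "y m < c" using s \<open>\<not> c \<le> y s\<close> by (meson atLeastAtMost_iff le_less_trans not_le order_refl)
  then have "m > 0" using m(1) y0 by (cases "m = 0") auto
  from pos[of m] \<open>y m < c\<close> m(1) have "0 < y' m" by simp
  then obtain d where "d > 0" and d: "\<And>h. h > 0 \<Longrightarrow> m - h \<in> {0..} \<Longrightarrow> h < d \<Longrightarrow> y (m - h) < y m"
    using has_real_derivative_pos_inc_left[OF y[of m]] m(1) by fastforce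
  define h where "h = min m (d / 2)"
  have "0 < h" "h \<le> m" "h < d" using \<open>m > 0\<close> \<open>d > 0\<close> by (auto simp: h_def)
  then have "y (m - h) < y m" "m - h \<in> {0..s}" using d[of h] m(1) by auto
  with m(2)[of "m - h"] show False by linarith
qed

lemma barrier_above:
  fixes y :: "real \<Rightarrow> real"
  assumes y: "\<And>s. 0 \<le> s \<Longrightarrow> (y has_real_derivative y' s) (at s within {0..})"
    and y0: "y 0 \<le> c" and neg: "\<And>s. 0 \<le> s \<Longrightarrow> c \<le> y s \<Longrightarrow> y' s < 0" and s: "0 \<le> s"
  shows "y s \<le> c"
  using barrier_below[of "\<lambda>s. - y s" "\<lambda>s. - y' s" "- c" s] y0 neg s
  by (force intro: derivative_intros y)

section \<open>Continuously factored increments of functions of two variables\<close>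

text \<open>On convex sets this is the \<open>C\<^sup>1\<close> property (Hadamard's lemma; the factors \<open>A\<close>, \<open>B\<close> restrict to the
  partial derivatives on the diagonal).  In this form it passes to sums, products and compositions by
  algebra alone, and the factors reappear as coefficients of a linear equation for increments of
  solutions.\<close>

definition divided_C1 :: "(real \<times> real) set \<Rightarrow> (real \<times> real \<Rightarrow> real) \<Rightarrow> bool" where
  "divided_C1 S F \<longleftrightarrow> (\<exists>A B. continuous_on (S \<times> S) A \<and> continuous_on (S \<times> S) B \<and>
     (\<forall>p\<in>S. \<forall>p'\<in>S. F p' - F p = A (p, p') * (fst p' - fst p) + B (p, p') * (snd p' - snd p)))"

lemma divided_C1I:
  assumes "continuous_on (S \<times> S) A" "continuous_on (S \<times> S) B"
    and "\<And>p p'. p \<in> S \<Longrightarrow> p' \<in> S \<Longrightarrow> F p' - F p = A (p, p') * (fst p' - fst p) + B (p, p') * (snd p' - snd p)"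
  shows "divided_C1 S F"
  using assms unfolding divided_C1_def by blast

lemma divided_C1E:
  assumes "divided_C1 S F"
  obtains A B where "continuous_on (S \<times> S) A" "continuous_on (S \<times> S) B"
    and "\<And>p p'. p \<in> S \<Longrightarrow> p' \<in> S \<Longrightarrow> F p' - F p = A (p, p') * (fst p' - fst p) + B (p, p') * (snd p' - snd p)"
  using assms unfolding divided_C1_def by blast

lemma divided_C1_imp_continuous_on:
  assumes "divided_C1 S F"
  shows "continuous_on S F"
proof (cases "S = {}")
  case False
  then obtain p where p: "p \<in> S" by auto
  from assms obtain A B where A: "continuous_on (S \<times> S) A" and B: "continuous_on (S \<times> S) B"
    and eq: "\<And>p p'. p \<in> S \<Longrightarrow> p' \<in> S \<Longrightarrow> F p' - F p = A (p, p') * (fst p' - fst p) + B (p, p') * (snd p' - snd p)"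
    by (rule divided_C1E) blast
  have "continuous_on S (\<lambda>p'. F p + A (p, p') * (fst p' - fst p) + B (p, p') * (snd p' - snd p))"
    by (intro continuous_intros continuous_on_compose2[OF A] continuous_on_compose2[OF B]) (use p in auto)
  then show ?thesis
    by (rule continuous_on_eq) (use eq[OF p] in \<open>auto simp: algebra_simps\<close>)
qed auto

section \<open>Closure properties of \<open>divided_C1\<close>\<close>

lemma divided_C1_cong:
  assumes "divided_C1 S F" "\<And>p. p \<in> S \<Longrightarrow> G p = F p"
  shows "divided_C1 S G"
  using assms unfolding divided_C1_def by simp

lemma divided_C1_subset: "divided_C1 S F \<Longrightarrow> T \<subseteq> S \<Longrightarrow> divided_C1 T F"
  unfolding divided_C1_def by (meson Sigma_mono continuous_on_subset subsetD)

text \<open>Serves \<open>g\<close>, whose arguments enter the system in exchanged order; the two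
  factors change places along with the coordinates.\<close>

lemma divided_C1_swap:
  assumes "divided_C1 S F"
  shows "divided_C1 (prod.swap ` S) (\<lambda>p. F (prod.swap p))"
proof -
  from assms obtain A B where A: "continuous_on (S \<times> S) A" and B: "continuous_on (S \<times> S) B"
    and eq: "\<And>p p'. p \<in> S \<Longrightarrow> p' \<in> S \<Longrightarrow> F p' - F p = A (p, p') * (fst p' - fst p) + B (p, p') * (snd p' - snd p)"
    by (rule divided_C1E) blast
  let ?sw = "\<lambda>w::(real \<times> real) \<times> real \<times> real. (prod.swap (fst w), prod.swap (snd w))"
  have sw: "continuous_on T ?sw" for T
    by (auto simp: prod.swap_def intro!: continuous_intros)
  show ?thesis
    by (rule divided_C1I[where A="\<lambda>w. B (?sw w)" and B="\<lambda>w. A (?sw w)"])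
       (auto intro!: continuous_on_compose2[OF A sw] continuous_on_compose2[OF B sw] simp: eq)
qed

lemma divided_C1_const [intro]: "divided_C1 S (\<lambda>p. c)"
  by (rule divided_C1I[where A="\<lambda>_. 0" and B="\<lambda>_. 0"]) auto

lemma divided_C1_fst [intro]: "divided_C1 S fst"
  by (rule divided_C1I[where A="\<lambda>_. 1" and B="\<lambda>_. 0"]) auto

lemma divided_C1_snd [intro]: "divided_C1 S snd"
  by (rule divided_C1I[where A="\<lambda>_. 0" and B="\<lambda>_. 1"]) auto

lemma divided_C1_add [intro]:
  assumes "divided_C1 S F" "divided_C1 S G"
  shows "divided_C1 S (\<lambda>p. F p + G p)"
proof -
  from assms(1) obtain A B where A: "continuous_on (S \<times> S) A" and B: "continuous_on (S \<times> S) B"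
    and eq: "\<And>p p'. p \<in> S \<Longrightarrow> p' \<in> S \<Longrightarrow> F p' - F p = A (p, p') * (fst p' - fst p) + B (p, p') * (snd p' - snd p)"
    by (rule divided_C1E) blast
  from assms(2) obtain A' B' where A': "continuous_on (S \<times> S) A'" and B': "continuous_on (S \<times> S) B'"
    and eq': "\<And>p p'. p \<in> S \<Longrightarrow> p' \<in> S \<Longrightarrow> G p' - G p = A' (p, p') * (fst p' - fst p) + B' (p, p') * (snd p' - snd p)"
    by (rule divided_C1E) blast
  show ?thesis
  proof (rule divided_C1I)
    show "continuous_on (S \<times> S) (\<lambda>w. A w + A' w)" "continuous_on (S \<times> S) (\<lambda>w. B w + B' w)"
      by (intro continuous_intros A A' B B')+
    fix p p' assume "p \<in> S" "p' \<in> S"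
    from eq[OF this] eq'[OF this]
    show "F p' + G p' - (F p + G p) = (A (p, p') + A' (p, p')) * (fst p' - fst p) + (B (p, p') + B' (p, p')) * (snd p' - snd p)"
      by (simp add: algebra_simps)
  qed
qed

lemma divided_C1_mult [intro]:
  assumes "divided_C1 S F" "divided_C1 S G"
  shows "divided_C1 S (\<lambda>p. F p * G p)"
proof -
  from assms(1) obtain A B where A: "continuous_on (S \<times> S) A" and B: "continuous_on (S \<times> S) B"
    and eq: "\<And>p p'. p \<in> S \<Longrightarrow> p' \<in> S \<Longrightarrow> F p' - F p = A (p, p') * (fst p' - fst p) + B (p, p') * (snd p' - snd p)"
    by (rule divided_C1E) blast
  from assms(2) obtain A' B' where A': "continuous_on (S \<times> S) A'" and B': "continuous_on (S \<times> S) B'"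
    and eq': "\<And>p p'. p \<in> S \<Longrightarrow> p' \<in> S \<Longrightarrow> G p' - G p = A' (p, p') * (fst p' - fst p) + B' (p, p') * (snd p' - snd p)"
    by (rule divided_C1E) blast
  have F: "continuous_on (S \<times> S) (\<lambda>w. F (snd w))" and G: "continuous_on (S \<times> S) (\<lambda>w. G (fst w))"
    by (rule continuous_on_compose2[OF divided_C1_imp_continuous_on[OF assms(1)]]
             continuous_on_compose2[OF divided_C1_imp_continuous_on[OF assms(2)]];
        auto intro: continuous_intros)+
  show ?thesis
  proof (rule divided_C1I)
    show "continuous_on (S \<times> S) (\<lambda>w. F (snd w) * A' w + G (fst w) * A w)"
      "continuous_on (S \<times> S) (\<lambda>w. F (snd w) * B' w + G (fst w) * B w)"
      by (intro continuous_intros A A' B B' F G)+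
    fix p p' assume p: "p \<in> S" "p' \<in> S"
    \<comment> \<open>The discrete product rule evaluates \<open>F\<close> at the second point and
      \<open>G\<close> at the first, whence the factors chosen above.\<close>
    have "F p' * G p' - F p * G p = F p' * (G p' - G p) + (F p' - F p) * G p"
      by (simp add: algebra_simps)
    then show "F p' * G p' - F p * G p =
        (F (snd (p, p')) * A' (p, p') + G (fst (p, p')) * A (p, p')) * (fst p' - fst p) +
        (F (snd (p, p')) * B' (p, p') + G (fst (p, p')) * B (p, p')) * (snd p' - snd p)"
      unfolding eq[OF p] eq'[OF p] by (simp add: algebra_simps)
  qed
qed

lemma divided_C1_diff [intro]:
  assumes "divided_C1 S F" "divided_C1 S G"
  shows "divided_C1 S (\<lambda>p. F p - G p)"
  using divided_C1_add[OF assms(1) divided_C1_mult[OF divided_C1_const[of S "-1"] assms(2)]] by simp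

lemma divided_C1_sum:
  "(\<And>k. k \<in> K \<Longrightarrow> divided_C1 S (F k)) \<Longrightarrow> divided_C1 S (\<lambda>p. \<Sum>k\<in>K. F k p)"
  by (induction K rule: infinite_finite_induct) auto

text \<open>The chain rule: the mean of \<open>h\<close> between \<open>F p\<close> and
  \<open>F p'\<close> is a continuous function of the pair and multiplies both factors of
  \<open>F\<close>.\<close>

lemma divided_C1_compose:
  assumes F: "divided_C1 S F" and I: "convex I" and FI: "\<And>p. p \<in> S \<Longrightarrow> F p \<in> I"
    and H: "\<And>z. z \<in> I \<Longrightarrow> (H has_real_derivative h z) (at z within I)" and h: "continuous_on I h"
  shows "divided_C1 S (\<lambda>p. H (F p))"
proof -
  from F obtain A B where A: "continuous_on (S \<times> S) A" and B: "continuous_on (S \<times> S) B"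
    and eq: "\<And>p p'. p \<in> S \<Longrightarrow> p' \<in> S \<Longrightarrow> F p' - F p = A (p, p') * (fst p' - fst p) + B (p, p') * (snd p' - snd p)"
    by (rule divided_C1E) blast
  note Fc = continuous_on_compose2[OF divided_C1_imp_continuous_on[OF F]]
  have M: "continuous_on (S \<times> S) (\<lambda>w. segment_mean h (F (fst w)) (F (snd w)))"
    by (rule continuous_on_segment_mean'[OF h I])
       (auto intro!: Fc continuous_intros FI)
  show ?thesis
  proof (rule divided_C1I)
    show "continuous_on (S \<times> S) (\<lambda>w. segment_mean h (F (fst w)) (F (snd w)) * A w)"
      "continuous_on (S \<times> S) (\<lambda>w. segment_mean h (F (fst w)) (F (snd w)) * B w)"
      by (intro continuous_intros A B M)+
    fix p p' assume p: "p \<in> S" "p' \<in> S"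
    have "H (F p') - H (F p) = (F p' - F p) * segment_mean h (F p) (F p')"
      by (rule increment_eq_segment_mean[OF I]) (use p FI H in auto)
    then show "H (F p') - H (F p) =
        segment_mean h (F (fst (p, p'))) (F (snd (p, p'))) * A (p, p') * (fst p' - fst p) +
        segment_mean h (F (fst (p, p'))) (F (snd (p, p'))) * B (p, p') * (snd p' - snd p)"
      unfolding eq[OF p] by (simp add: algebra_simps)
  qed
qed

section \<open>Relatively elementary functions and Lipschitz bounds\<close>

lemma divided_C1_powr:
  assumes "divided_C1 S F" "\<And>p. p \<in> S \<Longrightarrow> 0 < F p"
  shows "divided_C1 S (\<lambda>p. F p powr c)"
  by (rule divided_C1_compose[OF assms(1), where I="{0<..}" and h="\<lambda>z. c * z powr (c - 1)"])
     (use assms(2) in \<open>auto intro!: derivative_eq_intros continuous_intros\<close>)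

lemma divided_C1_inverse:
  assumes "divided_C1 S F" "\<And>p. p \<in> S \<Longrightarrow> 0 < F p"
  shows "divided_C1 S (\<lambda>p. inverse (F p))"
  by (rule divided_C1_cong[OF divided_C1_powr[OF assms, where c="-1"]])
     (use assms(2) in \<open>auto simp: powr_minus less_imp_le\<close>)

lemma relatively_elementary_imp_divided_C1:
  assumes "relatively_elementary t f" and "t > 0"
  shows "divided_C1 ({0<..} \<times> {0<..}) (\<lambda>p. f (fst p) (snd p))"
proof -
  from assms(1) obtain m l :: nat and \<alpha> \<beta> :: "nat \<Rightarrow> real" and a b :: "nat \<Rightarrow> rat \<times> rat" where "l \<ge> 1"
    and f: "\<And>z1 z2. z1 > 0 \<Longrightarrow> z2 > 0 \<Longrightarrow> f z1 z2 =
           (\<Sum>k=1..m. t powr \<alpha> k * (z1 powr of_rat (fst (a k)) * z2 powr of_rat (snd (a k)))) /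
           (\<Sum>k=1..l. t powr \<beta> k * (z1 powr of_rat (fst (b k)) * z2 powr of_rat (snd (b k))))"
    unfolding relatively_elementary_def by blast
  let ?Q = "{0<..} \<times> {0<..} :: (real \<times> real) set"
  define N where "N p = (\<Sum>k=1..m. t powr \<alpha> k * (fst p powr of_rat (fst (a k)) * snd p powr of_rat (snd (a k))))" for p :: "real \<times> real"
  define D where "D p = (\<Sum>k=1..l. t powr \<beta> k * (fst p powr of_rat (fst (b k)) * snd p powr of_rat (snd (b k))))" for p :: "real \<times> real"
  have N: "divided_C1 ?Q N" and D: "divided_C1 ?Q D"
    unfolding N_def D_def using \<open>t > 0\<close> by (auto intro!: divided_C1_sum divided_C1_mult divided_C1_powr)
  \<comment> \<open>All summands are positive, and \<open>l \<ge> 1\<close> excludes the empty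
    sum.\<close>
  have "0 < D p" if "p \<in> ?Q" for p
    unfolding D_def by (rule sum_pos) (use that \<open>l \<ge> 1\<close> \<open>t > 0\<close> in auto)
  then have "divided_C1 ?Q (\<lambda>p. N p * inverse (D p))"
    using N D by (intro divided_C1_mult divided_C1_inverse) auto
  then show ?thesis
    by (rule divided_C1_cong) (auto simp: f N_def D_def divide_inverse)
qed

text \<open>The factors are continuous on the compact set \<open>K \<times> K\<close>, hence
  bounded, and the identity holds for every pair of points, so \<open>K\<close> may have any
  shape.\<close>

lemma divided_C1_imp_Lipschitz:
  assumes F: "divided_C1 K F" and K: "compact K"
  obtains L where "0 < L"
    "\<And>p p'. p \<in> K \<Longrightarrow> p' \<in> K \<Longrightarrow> \<bar>F p' - F p\<bar> \<le> L * (\<bar>fst p' - fst p\<bar> + \<bar>snd p' - snd p\<bar>)"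
proof -
  from F obtain A B where A: "continuous_on (K \<times> K) A" and B: "continuous_on (K \<times> K) B"
    and eq: "\<And>p p'. p \<in> K \<Longrightarrow> p' \<in> K \<Longrightarrow> F p' - F p = A (p, p') * (fst p' - fst p) + B (p, p') * (snd p' - snd p)"
    by (rule divided_C1E) blast
  obtain a where a: "\<And>w. w \<in> K \<times> K \<Longrightarrow> \<bar>A w\<bar> \<le> a"
    using compact_imp_bounded[OF compact_continuous_image[OF A compact_Times[OF K K]]]
    by (auto simp: bounded_iff)
  obtain b where b: "\<And>w. w \<in> K \<times> K \<Longrightarrow> \<bar>B w\<bar> \<le> b"
    using compact_imp_bounded[OF compact_continuous_image[OF B compact_Times[OF K K]]]
    by (auto simp: bounded_iff)
  show ?thesis
  proof (rule that[of "max 1 (max a b)"])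
    fix p p' assume p: "p \<in> K" "p' \<in> K"
    have "\<bar>F p' - F p\<bar> \<le> \<bar>A (p, p')\<bar> * \<bar>fst p' - fst p\<bar> + \<bar>B (p, p')\<bar> * \<bar>snd p' - snd p\<bar>"
      unfolding eq[OF p] by (metis abs_mult abs_triangle_ineq)
    also have "\<dots> \<le> max 1 (max a b) * \<bar>fst p' - fst p\<bar> + max 1 (max a b) * \<bar>snd p' - snd p\<bar>"
      using a[of "(p, p')"] b[of "(p, p')"] p by (intro add_mono mult_right_mono) auto
    finally show "\<bar>F p' - F p\<bar> \<le> max 1 (max a b) * (\<bar>fst p' - fst p\<bar> + \<bar>snd p' - snd p\<bar>)"
      by (simp add: distrib_left)
  qed simp
qed

section \<open>The Goursat problem for Lipschitz right-hand sides\<close>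

lemma segment_mean_diff:
  assumes "continuous_on UNIV h" "continuous_on UNIV g"
  shows "segment_mean (\<lambda>z. h z - g z) x y = segment_mean h x y - segment_mean g x y"
  unfolding segment_mean_def
  by (rule Henstock_Kurzweil_Integration.integral_diff)
     (auto intro!: integrable_continuous_real continuous_intros continuous_on_compose2[OF assms(1)]
        continuous_on_compose2[OF assms(2)])

text \<open>Integrating an exponential of rate \<open>k\<close> gains the factor
  \<open>1 / k\<close>, uniformly in \<open>s\<close>; a large \<open>k\<close> therefore yields
  smallness on an unbounded domain. Absolute values cover negative \<open>s\<close> as well.\<close>

lemma segment_mean_exp_bound:
  assumes h: "continuous_on UNIV h" and k: "0 < k" and b: "\<And>\<sigma>. \<bar>h \<sigma>\<bar> \<le> C * exp (k * \<bar>\<sigma>\<bar>)"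
  shows "\<bar>s * segment_mean h 0 s\<bar> \<le> C / k * exp (k * \<bar>s\<bar>)"
proof -
  have "0 \<le> C" using b[of 0] by simp
  have "((\<lambda>\<theta>. C * (\<bar>s\<bar> * exp (k * (\<theta> * \<bar>s\<bar>)))) has_integral C / k * exp (k * (1 * \<bar>s\<bar>)) - C / k * exp (k * (0 * \<bar>s\<bar>))) {0..1}"
    by (rule fundamental_theorem_of_calculus)
       (use k in \<open>auto intro!: derivative_eq_intros simp flip: has_real_derivative_iff_has_vector_derivative\<close>)
  moreover have "((\<lambda>\<theta>. s * h (\<theta> * s)) has_integral s * segment_mean h 0 s) {0..1}"
    unfolding segment_mean_def
    by (intro has_integral_mult_right)
       (auto intro!: integrable_integral integrable_continuous_real continuous_on_compose2[OF h] continuous_intros)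
  moreover have "norm (s * h (\<theta> * s)) \<le> C * (\<bar>s\<bar> * exp (k * (\<theta> * \<bar>s\<bar>)))" if "\<theta> \<in> {0..1}" for \<theta>
    using mult_left_mono[OF b[of "\<theta> * s"], of "\<bar>s\<bar>"] that by (simp add: abs_mult mult_ac)
  ultimately have "norm (s * segment_mean h 0 s) \<le> C / k * exp (k * \<bar>s\<bar>) - C / k"
    using integral_norm_bound_integral[of "\<lambda>\<theta>. s * h (\<theta> * s)" "{0..1}" "\<lambda>\<theta>. C * (\<bar>s\<bar> * exp (k * (\<theta> * \<bar>s\<bar>)))"]
    by (auto simp: has_integral_iff)
  then show ?thesis using divide_nonneg_pos[OF \<open>0 \<le> C\<close> k] by simp
qed

lemma goursat_integral_solution:
  fixes F G :: "real \<times> real \<Rightarrow> real"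
  assumes L: "0 < L"
    and LF: "\<And>p p'. \<bar>F p' - F p\<bar> \<le> L * (\<bar>fst p' - fst p\<bar> + \<bar>snd p' - snd p\<bar>)"
    and LG: "\<And>p p'. \<bar>G p' - G p\<bar> \<le> L * (\<bar>fst p' - fst p\<bar> + \<bar>snd p' - snd p\<bar>)"
    and MF: "\<And>p. \<bar>F p\<bar> \<le> M" and MG: "\<And>p. \<bar>G p\<bar> \<le> M"
    and u0: "continuous_on {0..} u0" "\<And>x. 0 \<le> x \<Longrightarrow> \<bar>u0 x\<bar> \<le> C"
    and v0: "continuous_on {0..} v0" "\<And>s. 0 \<le> s \<Longrightarrow> \<bar>v0 s\<bar> \<le> C"
  obtains u v where
    "continuous_on UNIV (\<lambda>(x, s). u x s)" "continuous_on UNIV (\<lambda>(x, s). v x s)"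
    "\<And>x s. 0 \<le> x \<Longrightarrow> 0 \<le> s \<Longrightarrow> u x s = u0 x + s * segment_mean (\<lambda>\<sigma>. F (v x \<sigma>, u x \<sigma>)) 0 s"
    "\<And>x s. 0 \<le> x \<Longrightarrow> 0 \<le> s \<Longrightarrow> v x s = v0 s + x * segment_mean (\<lambda>y. G (u y s, v y s)) 0 x"
proof -
  \<comment> \<open>The weight \<open>exp (- k (x + s))\<close> makes the integral operator a contraction on the whole quadrant.\<close>
  define k where "k = 8 * L"
  have k: "0 < k" using L by (simp add: k_def)
  have "0 \<le> M" using MF[of 0] by linarith
  have "0 \<le> C" using u0(2)[of 0] by linarith
  \<comment> \<open>Absolute values extend the problem to the whole plane, so that bounded continuous functions on
    \<open>UNIV\<close> serve as the complete space.\<close>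
  define E where "E z = exp (k * (\<bar>fst z\<bar> + \<bar>snd z\<bar>))" for z :: "real \<times> real"
  have Epos: "0 < E z" for z by (simp add: E_def)
  have Emult: "E z = exp (k * \<bar>fst z\<bar>) * exp (k * \<bar>snd z\<bar>)" for z
    by (simp add: E_def distrib_left exp_add)
  have Emult': "E z = exp (k * \<bar>snd z\<bar>) * exp (k * \<bar>fst z\<bar>)" for z
    by (simp add: Emult)
  have Ec: "continuous_on T E" for T
    unfolding E_def by (intro continuous_intros)
  have lip_cont: "continuous_on UNIV H"
    if "\<And>p p'. \<bar>H p' - H p\<bar> \<le> L * (\<bar>fst p' - fst p\<bar> + \<bar>snd p' - snd p\<bar>)" for H :: "real \<times> real \<Rightarrow> real"
  proof (rule lipschitz_on_continuous_on[where L="2 * L"], rule lipschitz_onI)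
    fix p p' :: "real \<times> real"
    have "\<bar>fst p - fst p'\<bar> \<le> dist p p'" "\<bar>snd p - snd p'\<bar> \<le> dist p p'"
      using dist_fst_le[of p p'] dist_snd_le[of p p'] by (auto simp: dist_real_def)
    then have "L * (\<bar>fst p - fst p'\<bar> + \<bar>snd p - snd p'\<bar>) \<le> L * (2 * dist p p')"
      using L by (intro mult_left_mono) auto
    then show "dist (H p) (H p') \<le> 2 * L * dist p p'"
      using that[of p p'] by (simp add: dist_real_def)
  qed (use L in simp)
  note Fc = continuous_on_compose2[OF lip_cont[OF LF]] and Gc = continuous_on_compose2[OF lip_cont[OF LG]]

  \<comment> \<open>\<open>\<Phi>\<close> represents the weighted pair
    \<open>(u / E, v / E)\<close>; multiplying by \<open>E\<close> restores \<open>u\<close> and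
    \<open>v\<close> inside the right-hand sides. In \<open>NF\<close> and \<open>NG\<close> the
    integration variable is the last argument.\<close>
  define NF where "NF \<Phi> x \<sigma> = F (E (x, \<sigma>) * snd (apply_bcontfun \<Phi> (x, \<sigma>)), E (x, \<sigma>) * fst (apply_bcontfun \<Phi> (x, \<sigma>)))"
    for \<Phi> :: "(real \<times> real) \<Rightarrow>\<^sub>C (real \<times> real)" and x \<sigma>
  define NG where "NG \<Phi> s y = G (E (y, s) * fst (apply_bcontfun \<Phi> (y, s)), E (y, s) * snd (apply_bcontfun \<Phi> (y, s)))"
    for \<Phi> :: "(real \<times> real) \<Rightarrow>\<^sub>C (real \<times> real)" and s y
  note Ec' = continuous_on_compose2[OF Ec[of UNIV]]
    and \<Phi>c = continuous_on_compose2[OF continuous_on_apply_bcontfun[of UNIV]]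
  have NFc: "continuous_on UNIV (\<lambda>(\<sigma>, x). NF \<Phi> x \<sigma>)" and NGc: "continuous_on UNIV (\<lambda>(y, s). NG \<Phi> s y)" for \<Phi>
    unfolding NF_def NG_def split_beta
    by (rule Fc Gc; auto intro!: continuous_intros Ec' \<Phi>c)+
  have "continuous_on UNIV (\<lambda>\<sigma>. (\<lambda>(\<sigma>, x). NF \<Phi> x \<sigma>) (\<sigma>, x))"
    "continuous_on UNIV (\<lambda>y. (\<lambda>(y, s). NG \<Phi> s y) (y, s))" for \<Phi> x s
    by (rule continuous_on_compose2[OF NFc] continuous_on_compose2[OF NGc]; auto intro: continuous_intros)+
  then have NFc1: "continuous_on UNIV (NF \<Phi> x)" and NGc1: "continuous_on UNIV (NG \<Phi> s)" for \<Phi> x s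
    by auto

  define T0 where "T0 \<Phi> z =
     ((u0 \<bar>fst z\<bar> + snd z * segment_mean (NF \<Phi> (fst z)) 0 (snd z)) / E z,
      (v0 \<bar>snd z\<bar> + fst z * segment_mean (NG \<Phi> (snd z)) 0 (fst z)) / E z)"
    for \<Phi> :: "(real \<times> real) \<Rightarrow>\<^sub>C (real \<times> real)" and z
  \<comment> \<open>One component of the operator, written for a generic integration variable
    \<open>s\<close> so that it serves both \<open>u\<close> and \<open>v\<close>. The weight is at
    least 1, which handles the initial value \<open>c\<close>.\<close>
  have comp_bound: "\<bar>(c + s * segment_mean h 0 s) / (exp (k * a) * exp (k * \<bar>s\<bar>))\<bar> \<le> C + M / k"
    if h: "continuous_on UNIV h" "\<And>\<sigma>. \<bar>h \<sigma>\<bar> \<le> M" and c: "\<bar>c\<bar> \<le> C" and a: "0 \<le> a" for h c a s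
  proof -
    let ?D = "exp (k * a) * exp (k * \<bar>s\<bar>)"
    have "\<bar>h \<sigma>\<bar> \<le> M * exp (k * \<bar>\<sigma>\<bar>)" for \<sigma>
      using h(2)[of \<sigma>] mult_left_mono[of 1 "exp (k * \<bar>\<sigma>\<bar>)" M] \<open>0 \<le> M\<close> k by simp
    then have "\<bar>s * segment_mean h 0 s\<bar> \<le> M / k * exp (k * \<bar>s\<bar>)"
      by (rule segment_mean_exp_bound[OF h(1) k])
    also have "\<dots> \<le> M / k * ?D"
      using \<open>0 \<le> M\<close> k a by (intro mult_left_mono) auto
    finally have "\<bar>s * segment_mean h 0 s\<bar> \<le> M / k * ?D" .
    moreover have "1 \<le> ?D"
      using k a mult_mono[of 1 "exp (k * a)" 1 "exp (k * \<bar>s\<bar>)"] by simp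
    then have "\<bar>c\<bar> \<le> C * ?D"
      using c \<open>0 \<le> C\<close> mult_left_mono[of 1 ?D C] by simp
    ultimately have "\<bar>c + s * segment_mean h 0 s\<bar> \<le> (C + M / k) * ?D"
      unfolding distrib_right by linarith
    then show ?thesis by (simp add: abs_mult pos_divide_le_eq)
  qed
  \<comment> \<open>With \<open>D\<close> the distance of two weighted pairs, the Lipschitz bound
    adds two components and gives \<open>2 * D\<close>. Integration divides by
    \<open>k = 8 * L\<close>, leaving \<open>D / 4\<close> per component and \<open>D / 2\<close> in
    total.\<close>
  have comp_contr: "\<bar>(c + s * segment_mean h 0 s) / (exp (k * a) * exp (k * \<bar>s\<bar>))
      - (c + s * segment_mean g 0 s) / (exp (k * a) * exp (k * \<bar>s\<bar>))\<bar> \<le> D / 4"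
    if h: "continuous_on UNIV h" "continuous_on UNIV g"
      and d: "\<And>\<sigma>. \<bar>h \<sigma> - g \<sigma>\<bar> \<le> L * (2 * D) * (exp (k * a) * exp (k * \<bar>\<sigma>\<bar>))" for h g c a s D
  proof -
    have "\<bar>s * segment_mean (\<lambda>\<sigma>. h \<sigma> - g \<sigma>) 0 s\<bar> \<le> (L * (2 * D) * exp (k * a)) / k * exp (k * \<bar>s\<bar>)"
      by (rule segment_mean_exp_bound[OF _ k]) (use d h in \<open>auto intro: continuous_intros simp: mult.assoc\<close>)
    also have "\<dots> = D / 4 * (exp (k * a) * exp (k * \<bar>s\<bar>))"
      using L by (simp add: k_def)
    finally have "\<bar>(s * segment_mean h 0 s - s * segment_mean g 0 s) / (exp (k * a) * exp (k * \<bar>s\<bar>))\<bar> \<le> D / 4"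
      by (simp add: segment_mean_diff[OF h] right_diff_distrib abs_mult pos_divide_le_eq)
    then show ?thesis by (simp flip: diff_divide_distrib)
  qed
  have T0: "T0 \<Phi> \<in> bcontfun" for \<Phi>
  proof (rule bcontfun_normI)
    show "continuous_on UNIV (T0 \<Phi>)"
      unfolding T0_def
      by (intro continuous_intros Ec continuous_on_compose2[OF u0(1)] continuous_on_compose2[OF v0(1)]
            continuous_on_segment_mean[where h="\<lambda>\<sigma> x. NF \<Phi> x \<sigma>" and P=fst and I=UNIV and T=UNIV]
            continuous_on_segment_mean[where h="\<lambda>y s. NG \<Phi> s y" and P=snd and I=UNIV and T=UNIV])
         (use NFc NGc Epos in \<open>auto simp: less_imp_neq[symmetric] order_less_imp_not_eq2\<close>)
    fix z
    have "norm (fst (T0 \<Phi> z)) \<le> C + M / k"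
      using comp_bound[OF NFc1[of \<Phi> "fst z"], of "u0 \<bar>fst z\<bar>" "\<bar>fst z\<bar>" "snd z"] MF u0(2)[of "\<bar>fst z\<bar>"]
      by (simp add: T0_def Emult NF_def)
    moreover have "norm (snd (T0 \<Phi> z)) \<le> C + M / k"
      using comp_bound[OF NGc1[of \<Phi> "snd z"], of "v0 \<bar>snd z\<bar>" "\<bar>snd z\<bar>" "fst z"] MG v0(2)[of "\<bar>snd z\<bar>"]
      by (simp add: T0_def Emult NG_def mult.commute)
    ultimately show "norm (T0 \<Phi> z) \<le> 2 * (C + M / k)"
      using norm_Pair_le[of "fst (T0 \<Phi> z)" "snd (T0 \<Phi> z)"] by simp
  qed
  define T where "T \<Phi> = Bcontfun (T0 \<Phi>)" for \<Phi>
  have T: "apply_bcontfun (T \<Phi>) = T0 \<Phi>" for \<Phi>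
    unfolding T_def using T0 by (simp add: Bcontfun_inverse)
  have "\<exists>!\<Phi>. T \<Phi> = \<Phi>"
  proof (rule banach_fix_type[of "1/2"], goal_cases)
    case 3
    show ?case
    proof (intro allI dist_bound)
      fix \<Phi> \<Psi> :: "(real \<times> real) \<Rightarrow>\<^sub>C (real \<times> real)" and z :: "real \<times> real"
      let ?D = "dist \<Phi> \<Psi>"
      have fs: "\<bar>E w * fst (\<Phi> w) - E w * fst (\<Psi> w)\<bar> + \<bar>E w * snd (\<Phi> w) - E w * snd (\<Psi> w)\<bar> \<le> 2 * ?D * E w" for w
      proof -
        have "\<bar>fst (\<Phi> w) - fst (\<Psi> w)\<bar> \<le> ?D" "\<bar>snd (\<Phi> w) - snd (\<Psi> w)\<bar> \<le> ?D"
          using dist_fst_le[of "\<Phi> w" "\<Psi> w"] dist_snd_le[of "\<Phi> w" "\<Psi> w"] dist_bounded[of \<Phi> w \<Psi>]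
          by (auto simp: dist_real_def)
        then have "E w * (\<bar>fst (\<Phi> w) - fst (\<Psi> w)\<bar> + \<bar>snd (\<Phi> w) - snd (\<Psi> w)\<bar>) \<le> E w * (2 * ?D)"
          using Epos[of w] by (intro mult_left_mono) auto
        then show ?thesis
          using Epos[of w] by (simp add: abs_mult distrib_left mult_ac flip: right_diff_distrib)
      qed
      have "\<bar>NF \<Phi> x \<sigma> - NF \<Psi> x \<sigma>\<bar> \<le> L * (2 * ?D) * E (x, \<sigma>)" "\<bar>NG \<Phi> x \<sigma> - NG \<Psi> x \<sigma>\<bar> \<le> L * (2 * ?D) * E (\<sigma>, x)" for x \<sigma>
        unfolding NF_def NG_def mult.assoc[of L]
        by (rule order_trans[OF LF] order_trans[OF LG], rule mult_left_mono;
            use fs[of "(x, \<sigma>)"] fs[of "(\<sigma>, x)"] L in simp)+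
      note contr = this
      have "dist (fst (T0 \<Phi> z)) (fst (T0 \<Psi> z)) \<le> ?D / 4"
        using comp_contr[OF NFc1 NFc1, of \<Phi> "fst z" \<Psi> "fst z" ?D "\<bar>fst z\<bar>" "u0 \<bar>fst z\<bar>" "snd z"] contr(1)
        by (simp add: T0_def Emult dist_real_def)
      moreover have "dist (snd (T0 \<Phi> z)) (snd (T0 \<Psi> z)) \<le> ?D / 4"
        using comp_contr[OF NGc1 NGc1, of \<Phi> "snd z" \<Psi> "snd z" ?D "\<bar>snd z\<bar>" "v0 \<bar>snd z\<bar>" "fst z"] contr(2)
        by (simp add: T0_def Emult' dist_real_def)
      ultimately show "dist (T \<Phi> z) (T \<Psi> z) \<le> 1 / 2 * ?D"
        unfolding T dist_prod_def
        using sqrt_sum_squares_le_sum[of "dist (fst (T0 \<Phi> z)) (fst (T0 \<Psi> z))" "dist (snd (T0 \<Phi> z)) (snd (T0 \<Psi> z))"]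
        by simp
    qed
  qed auto
  then obtain \<Phi> where \<Phi>: "T \<Phi> = \<Phi>" by blast
  define u where "u x s = E (x, s) * fst (\<Phi> (x, s))" for x s
  define v where "v x s = E (x, s) * snd (\<Phi> (x, s))" for x s
  have fix1: "\<Phi> z = T0 \<Phi> z" for z using T[of \<Phi>] \<Phi> by simp
  have NFu: "NF \<Phi> x = (\<lambda>\<sigma>. F (v x \<sigma>, u x \<sigma>))" and NGu: "NG \<Phi> s = (\<lambda>y. G (u y s, v y s))" for x s
    by (auto simp: NF_def NG_def u_def v_def)
  show ?thesis
  proof (rule that[of u v])
    show "continuous_on UNIV (\<lambda>(x, s). u x s)" "continuous_on UNIV (\<lambda>(x, s). v x s)"
      unfolding u_def v_def split_beta by (auto intro!: continuous_intros Ec' \<Phi>c)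
    fix x s :: real assume xs: "0 \<le> x" "0 \<le> s"
    show "u x s = u0 x + s * segment_mean (\<lambda>\<sigma>. F (v x \<sigma>, u x \<sigma>)) 0 s"
      unfolding NFu[symmetric] u_def[of x s] using xs Epos[of "(x, s)"] by (subst fix1) (simp add: T0_def)
    show "v x s = v0 s + x * segment_mean (\<lambda>y. G (u y s, v y s)) 0 x"
      unfolding NGu[symmetric] v_def[of x s] using xs Epos[of "(x, s)"] by (subst fix1) (simp add: T0_def)
  qed
qed

section \<open>Uniqueness for the Goursat problem\<close>

lemma exp_growth_bound:
  fixes e e' :: "real \<Rightarrow> real"
  assumes e: "\<And>s. 0 \<le> s \<Longrightarrow> (e has_real_derivative e' s) (at s within {0..})"
    and e0: "e 0 = 0" and k: "0 < k" and b: "\<And>s. 0 \<le> s \<Longrightarrow> \<bar>e' s\<bar> \<le> C * exp (k * s)" and s: "0 \<le> s"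
  shows "\<bar>e s\<bar> \<le> C / k * exp (k * s)"
proof -
  have "0 \<le> C" using b[of 0] by simp
  show ?thesis
  proof (cases "s = 0")
    case True
    then show ?thesis using e0 \<open>0 \<le> C\<close> k by simp
  next
    case False
    \<comment> \<open>Mean value inequality against an antiderivative of the bound on
      \<open>e'\<close>.\<close>
    have "norm (e s - e 0) \<le> C / k * exp (k * s) - C / k * exp (k * 0)"
    proof (rule differentiable_bound_general)
      show "continuous_on {0..s} e"
        by (rule DERIV_continuous_on[where D=e']) (auto intro: DERIV_subset[OF e])
      fix \<sigma> :: real assume \<sigma>: "0 < \<sigma>"
      have "(e has_real_derivative e' \<sigma>) (at \<sigma> within {0<..})"
        by (rule DERIV_subset[OF e]) (use \<sigma> in auto)
      then show "(e has_vector_derivative e' \<sigma>) (at \<sigma>)"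
        using \<sigma> by (simp add: at_within_open[of \<sigma> "{0<..}"] has_real_derivative_iff_has_vector_derivative)
      show "((\<lambda>s. C / k * exp (k * s)) has_vector_derivative C * exp (k * \<sigma>)) (at \<sigma>)"
        using k by (auto intro!: derivative_eq_intros simp flip: has_real_derivative_iff_has_vector_derivative)
      show "norm (e' \<sigma>) \<le> C * exp (k * \<sigma>)" using b[of \<sigma>] \<sigma> by simp
    qed (use s False k in \<open>auto intro!: continuous_intros\<close>)
    then show ?thesis using e0 divide_nonneg_pos[OF \<open>0 \<le> C\<close> k] by simp
  qed
qed

text \<open>Any bound of the difference by \<open>D * exp (k * (x + s))\<close> improves to half of
  itself when inserted into the equations. Boundedness of \<open>I\<close> supplies a first bound,
  and iteration forces the difference to vanish.\<close>

lemma goursat_unique: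
  fixes F G :: "real \<times> real \<Rightarrow> real"
  assumes L: "0 < L"
    and LF: "\<And>p p'. p \<in> I \<times> I \<Longrightarrow> p' \<in> I \<times> I \<Longrightarrow> \<bar>F p' - F p\<bar> \<le> L * (\<bar>fst p' - fst p\<bar> + \<bar>snd p' - snd p\<bar>)"
    and LG: "\<And>p p'. p \<in> I \<times> I \<Longrightarrow> p' \<in> I \<times> I \<Longrightarrow> \<bar>G p' - G p\<bar> \<le> L * (\<bar>fst p' - fst p\<bar> + \<bar>snd p' - snd p\<bar>)"
    and I: "bounded I"
    and uv: "\<And>x s. 0 \<le> x \<Longrightarrow> 0 \<le> s \<Longrightarrow> u x s \<in> I \<and> v x s \<in> I"
    and uv': "\<And>x s. 0 \<le> x \<Longrightarrow> 0 \<le> s \<Longrightarrow> u' x s \<in> I \<and> v' x s \<in> I"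
    and us: "\<And>x s. 0 \<le> x \<Longrightarrow> 0 \<le> s \<Longrightarrow> (u x has_real_derivative F (v x s, u x s)) (at s within {0..})"
    and us': "\<And>x s. 0 \<le> x \<Longrightarrow> 0 \<le> s \<Longrightarrow> (u' x has_real_derivative F (v' x s, u' x s)) (at s within {0..})"
    and vx: "\<And>x s. 0 \<le> x \<Longrightarrow> 0 \<le> s \<Longrightarrow> ((\<lambda>y. v y s) has_real_derivative G (u x s, v x s)) (at x within {0..})"
    and vx': "\<And>x s. 0 \<le> x \<Longrightarrow> 0 \<le> s \<Longrightarrow> ((\<lambda>y. v' y s) has_real_derivative G (u' x s, v' x s)) (at x within {0..})"
    and u0: "\<And>x. 0 \<le> x \<Longrightarrow> u x 0 = u' x 0" and v0: "\<And>s. 0 \<le> s \<Longrightarrow> v 0 s = v' 0 s"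
    and xs: "0 \<le> x" "0 \<le> s"
  shows "u x s = u' x s \<and> v x s = v' x s"
proof -
  \<comment> \<open>Each of the two components is then bounded with constant
    \<open>L * D / k = D / 4\<close>, so their sum has constant \<open>D / 2\<close>.\<close>
  define k where "k = 4 * L"
  have k: "0 < k" using L by (simp add: k_def)
  define m where "m x s = \<bar>u x s - u' x s\<bar> + \<bar>v x s - v' x s\<bar>" for x s
  have halve: "m x s \<le> D / 2 * exp (k * (x + s))"
    if D: "\<And>x s. 0 \<le> x \<Longrightarrow> 0 \<le> s \<Longrightarrow> m x s \<le> D * exp (k * (x + s))" and xs: "0 \<le> x" "0 \<le> s" for D x s
  proof -
    have Lm: "L * m x s \<le> L * D * exp (k * x) * exp (k * s)" if "0 \<le> x" "0 \<le> s" for x s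
      using mult_left_mono[OF D[OF that], of L] L by (simp add: distrib_left exp_add mult_ac)
    have FL: "\<bar>F (v x s, u x s) - F (v' x s, u' x s)\<bar> \<le> L * m x s" if "0 \<le> x" "0 \<le> s" for x s
      using LF[of "(v' x s, u' x s)" "(v x s, u x s)"] uv[OF that] uv'[OF that] by (simp add: m_def add.commute)
    have "\<bar>F (v x s, u x s) - F (v' x s, u' x s)\<bar> \<le> L * D * exp (k * x) * exp (k * s)" if "0 \<le> s" for s
      using order_trans[OF FL Lm] that xs(1) by simp
    then have "\<bar>u x s - u' x s\<bar> \<le> L * D * exp (k * x) / k * exp (k * s)"
      by (intro exp_growth_bound[where e="\<lambda>s. u x s - u' x s" and e'="\<lambda>s. F (v x s, u x s) - F (v' x s, u' x s)"])
         (use xs k u0 in \<open>auto intro!: derivative_intros us us'\<close>)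
    moreover have GL: "\<bar>G (u x s, v x s) - G (u' x s, v' x s)\<bar> \<le> L * m x s" if "0 \<le> x" "0 \<le> s" for x s
      using LG[of "(u' x s, v' x s)" "(u x s, v x s)"] uv[OF that] uv'[OF that] by (simp add: m_def)
    have "\<bar>G (u x s, v x s) - G (u' x s, v' x s)\<bar> \<le> L * D * exp (k * s) * exp (k * x)" if "0 \<le> x" for x
      using order_trans[OF GL[OF that xs(2)] Lm[OF that xs(2)]] by (simp add: mult_ac)
    then have "\<bar>v x s - v' x s\<bar> \<le> L * D * exp (k * s) / k * exp (k * x)"
      by (intro exp_growth_bound[where e="\<lambda>x. v x s - v' x s" and e'="\<lambda>x. G (u x s, v x s) - G (u' x s, v' x s)"])
         (use xs k v0 in \<open>auto intro!: derivative_intros vx vx' simp: mult_ac\<close>)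
    moreover have "L * D * exp (k * x) / k * exp (k * s) = D / 4 * exp (k * (x + s))"
      "L * D * exp (k * s) / k * exp (k * x) = D / 4 * exp (k * (x + s))"
      using L by (simp_all add: k_def distrib_left exp_add)
    ultimately show ?thesis
      unfolding m_def by linarith
  qed
  obtain C where C: "\<And>z. z \<in> I \<Longrightarrow> \<bar>z\<bar> \<le> C" using I by (auto simp: bounded_iff)
  have "m x s \<le> 4 * C / 2 ^ n * exp (k * (x + s))" if "0 \<le> x" "0 \<le> s" for n x s
    using that
  proof (induction n arbitrary: x s)
    case 0
    have "m x s \<le> 4 * C"
      using C[of "u x s"] C[of "u' x s"] C[of "v x s"] C[of "v' x s"] uv[OF 0] uv'[OF 0] by (simp add: m_def)
    also have "\<dots> \<le> 4 * C * exp (k * (x + s))"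
      using C[of "u x s"] uv[OF 0] 0 k mult_left_mono[of 1 "exp (k * (x + s))" "4 * C"] by simp
    finally show ?case by simp
  next
    case (Suc n)
    show ?case using halve[of "4 * C / 2 ^ n" x s] Suc by (simp add: mult.commute)
  qed
  then have "m x s \<le> 4 * C / 2 ^ n * exp (k * (x + s))" for n
    using xs by blast
  moreover have "(\<lambda>n. 4 * C / 2 ^ n * exp (k * (x + s))) \<longlonglongrightarrow> 0"
    using tendsto_mult[OF tendsto_const[of "4 * C * exp (k * (x + s))"] LIMSEQ_inverse_realpow_zero[of 2]]
    by (simp add: field_simps)
  ultimately have "m x s \<le> 0"
    by (intro LIMSEQ_le_const) auto
  then have "\<bar>u x s - u' x s\<bar> = 0" "\<bar>v x s - v' x s\<bar> = 0"
    unfolding m_def by linarith+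
  then show ?thesis by simp
qed

section \<open>Differentiability in the parameter\<close>

text \<open>Off the diagonal \<open>g\<close> is the difference quotient, and continuity at
  \<open>x\<close> identifies its limit.\<close>

lemma DERIV_quotient_limit:
  fixes f g :: "real \<Rightarrow> real"
  assumes "continuous (at x within S) g" and "x \<in> S"
    and eq: "\<And>y. y \<in> S \<Longrightarrow> f y - f x = (y - x) * g y"
  shows "(f has_real_derivative g x) (at x within S)"
proof -
  have "(g \<longlongrightarrow> g x) (at x within S)"
    using assms(1) by (simp add: continuous_within)
  moreover have "\<forall>\<^sub>F y in at x within S. g y = (f y - f x) / (y - x)"
    using eq by (auto simp: eventually_at_filter)
  ultimately show ?thesis
    unfolding has_field_derivative_iff using tendsto_cong by fast
qed

text \<open>Here \<open>s\<close> is the evolution variable and \<open>x\<close> the parameter. Only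
  continuity of \<open>u\<close> in \<open>x\<close> is presupposed; differentiability comes out of
  the factorisation of increments. Exchanging the coordinates gives the corresponding result for
  \<open>v\<close>.\<close>

lemma parameter_derivative:
  fixes u v w :: "real \<Rightarrow> real \<Rightarrow> real" and h h' :: "real \<Rightarrow> real"
  assumes F: "divided_C1 K F"
    and uc: "continuous_on ({0..} \<times> {0..}) (\<lambda>(x, s). u x s)"
    and vc: "continuous_on ({0..} \<times> {0..}) (\<lambda>(x, s). v x s)"
    and K: "\<And>x s. 0 \<le> x \<Longrightarrow> 0 \<le> s \<Longrightarrow> (v x s, u x s) \<in> K"
    and us: "\<And>x s. 0 \<le> x \<Longrightarrow> 0 \<le> s \<Longrightarrow> (u x has_real_derivative F (v x s, u x s)) (at s within {0..})"
    and vx: "\<And>x s. 0 \<le> x \<Longrightarrow> 0 \<le> s \<Longrightarrow> ((\<lambda>y. v y s) has_real_derivative w x s) (at x within {0..})"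
    and wc: "continuous_on ({0..} \<times> {0..}) (\<lambda>(x, s). w x s)"
    and h: "\<And>x. 0 \<le> x \<Longrightarrow> (h has_real_derivative h' x) (at x within {0..})"
    and hc: "continuous_on {0..} h'"
    and u0: "\<And>x. 0 \<le> x \<Longrightarrow> u x 0 = h x"
  obtains ux where "continuous_on ({0..} \<times> {0..}) (\<lambda>(x, s). ux x s)"
    "\<And>x s. 0 \<le> x \<Longrightarrow> 0 \<le> s \<Longrightarrow> ((\<lambda>y. u y s) has_real_derivative ux x s) (at x within {0..})"
proof -
  from F obtain A B where A: "continuous_on (K \<times> K) A" and B: "continuous_on (K \<times> K) B"
    and eq: "\<And>p p'. p \<in> K \<Longrightarrow> p' \<in> K \<Longrightarrow> F p' - F p = A (p, p') * (fst p' - fst p) + B (p, p') * (snd p' - snd p)"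
    by (rule divided_C1E) blast
  \<comment> \<open>Variation of constants: \<open>\<beta>\<close> is the integral of the
    coefficient \<open>b\<close>, so \<open>exp (- \<beta>)\<close> is the integrating factor.
    \<open>J\<close> starts from the divided difference of the initial values and adds the integral
    of the transformed inhomogeneity \<open>c\<close>.\<close>
  define a where "a x y \<sigma> = A ((v x \<sigma>, u x \<sigma>), (v y \<sigma>, u y \<sigma>))" for x y \<sigma>
  define b where "b x y \<sigma> = B ((v x \<sigma>, u x \<sigma>), (v y \<sigma>, u y \<sigma>))" for x y \<sigma>
  define \<Gamma> where "\<Gamma> x y \<sigma> = segment_mean (\<lambda>z. w z \<sigma>) x y" for x y \<sigma>
  define \<beta> where "\<beta> x y s = s * segment_mean (b x y) 0 s" for x y s
  define c where "c x y \<sigma> = exp (- \<beta> x y \<sigma>) * (a x y \<sigma> * \<Gamma> x y \<sigma>)" for x y \<sigma>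
  define J where "J x y s = segment_mean h' x y + s * segment_mean (c x y) 0 s" for x y s
  define P where "P x y s = exp (\<beta> x y s) * J x y s" for x y s

  \<comment> \<open>Triples are ordered as \<open>(\<sigma>, x, y)\<close>: the integration variable
    first, the two parameters behind it, as \<open>continuous_on_segment_mean\<close>
    expects.\<close>
  let ?D = "{0..} \<times> {0..} \<times> {0..} :: (real \<times> real \<times> real) set"
  have ucD: "continuous_on ?D (\<lambda>z. u (X z) (Y z))" and vcD: "continuous_on ?D (\<lambda>z. v (X z) (Y z))"
    if "continuous_on ?D X" "continuous_on ?D Y" "\<And>z. z \<in> ?D \<Longrightarrow> 0 \<le> X z" "\<And>z. z \<in> ?D \<Longrightarrow> 0 \<le> Y z" for X Y
    using continuous_on_compose2[OF uc continuous_on_Pair[OF that(1,2)]]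
      continuous_on_compose2[OF vc continuous_on_Pair[OF that(1,2)]] that(3,4)
    by (auto simp: image_subset_iff)
  have ac: "continuous_on ?D (\<lambda>(\<sigma>, p). a (fst p) (snd p) \<sigma>)" and bc: "continuous_on ?D (\<lambda>(\<sigma>, p). b (fst p) (snd p) \<sigma>)"
    unfolding a_def b_def split_beta
    by (rule continuous_on_compose2[OF A] continuous_on_compose2[OF B]; use K in \<open>auto intro!: continuous_intros ucD vcD\<close>)+
  have \<Gamma>c: "continuous_on ?D (\<lambda>(\<sigma>, p). \<Gamma> (fst p) (snd p) \<sigma>)"
    unfolding \<Gamma>_def split_beta
    by (rule continuous_on_segment_mean[OF wc]) (auto intro!: continuous_intros)
  have \<beta>c: "continuous_on ?D (\<lambda>(\<sigma>, p). \<beta> (fst p) (snd p) \<sigma>)"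
    unfolding \<beta>_def split_beta
    by (intro continuous_intros continuous_on_segment_mean[where h="\<lambda>\<sigma> p. b (fst p) (snd p) \<sigma>" and I="{0..}" and T="{0..} \<times> {0..}"])
       (use bc in \<open>auto simp: split_beta\<close>)
  have cc: "continuous_on ?D (\<lambda>(\<sigma>, p). c (fst p) (snd p) \<sigma>)"
    using ac \<Gamma>c \<beta>c unfolding c_def split_beta by (intro continuous_intros)
  have Pc: "continuous_on ?D (\<lambda>(\<sigma>, p). P (fst p) (snd p) \<sigma>)"
    using \<beta>c unfolding P_def J_def split_beta
    by (intro continuous_intros continuous_on_segment_mean[where h="\<lambda>\<sigma> p. c (fst p) (snd p) \<sigma>" and I="{0..}" and T="{0..} \<times> {0..}"]
          continuous_on_segment_mean'[OF hc])
       (use cc in \<open>auto simp: split_beta\<close>)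

  \<comment> \<open>\<open>\<sigma> \<mapsto> u y \<sigma> - u x \<sigma>\<close> solves the linear equation \<open>d' = b d + (y - x) a \<Gamma>\<close>, and \<open>P\<close> is its explicit
    solution divided by \<open>y - x\<close>, which makes sense and is continuous also for \<open>y = x\<close>.\<close>
  have inc: "u y s - u x s = (y - x) * P x y s" if xy: "0 \<le> x" "0 \<le> y" and s: "0 \<le> s" for x y s
  proof -
    have slice: "continuous_on {0..} (\<lambda>\<sigma>. H (\<sigma>, x, y))" if "continuous_on ?D H" for H :: "real \<times> real \<times> real \<Rightarrow> real"
      by (rule continuous_on_compose2[OF that]) (use xy in \<open>auto intro!: continuous_intros\<close>)
    have b1: "continuous_on {0..} (b x y)" and c1: "continuous_on {0..} (c x y)"
      using slice[OF bc] slice[OF cc] by simp_all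
    \<comment> \<open>The defect of the claimed formula after multiplication by the integrating
      factor; it is constant and vanishes at 0.\<close>
    define e where "e \<sigma> = exp (- \<beta> x y \<sigma>) * (u y \<sigma> - u x \<sigma>) - (y - x) * J x y \<sigma>" for \<sigma>
    have "(e has_real_derivative 0) (at \<sigma> within {0..})" if \<sigma>: "0 \<le> \<sigma>" for \<sigma>
    proof -
      have d\<beta>: "(\<beta> x y has_real_derivative b x y \<sigma>) (at \<sigma> within {0..})"
        unfolding \<beta>_def by (rule has_real_derivative_segment_mean[OF b1 \<sigma>])
      have dJ: "(J x y has_real_derivative c x y \<sigma>) (at \<sigma> within {0..})"
        unfolding J_def using DERIV_add[OF DERIV_const has_real_derivative_segment_mean[OF c1 \<sigma>]] by simp
      have "v y \<sigma> - v x \<sigma> = (y - x) * \<Gamma> x y \<sigma>"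
        unfolding \<Gamma>_def by (rule increment_eq_segment_mean[where I="{0..}"]) (use xy \<sigma> vx in auto)
      then have Feq: "F (v y \<sigma>, u y \<sigma>) - F (v x \<sigma>, u x \<sigma>) = a x y \<sigma> * ((y - x) * \<Gamma> x y \<sigma>) + b x y \<sigma> * (u y \<sigma> - u x \<sigma>)"
        using eq[OF K K, of x \<sigma> y \<sigma>] xy \<sigma> by (simp add: a_def b_def)
      have "(e has_real_derivative exp (- \<beta> x y \<sigma>) * - b x y \<sigma> * (u y \<sigma> - u x \<sigma>) +
          (F (v y \<sigma>, u y \<sigma>) - F (v x \<sigma>, u x \<sigma>)) * exp (- \<beta> x y \<sigma>) - c x y \<sigma> * (y - x)) (at \<sigma> within {0..})"
        unfolding e_def
        by (rule DERIV_diff DERIV_mult DERIV_cmult_right DERIV_minus d\<beta> us xy \<sigma>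
              DERIV_fun_exp | rule DERIV_chain2[OF DERIV_exp] | subst mult.commute[of "y - x"], rule DERIV_cmult_right, rule dJ)+
      then show ?thesis
        unfolding Feq by (simp add: c_def algebra_simps)
    qed
    then obtain C where C: "\<And>\<sigma>. 0 \<le> \<sigma> \<Longrightarrow> e \<sigma> = C"
      using has_field_derivative_zero_constant[of "{0..}" e] by auto
    have "h y - h x = (y - x) * segment_mean h' x y"
      by (rule increment_eq_segment_mean[where I="{0..}"]) (use xy h in auto)
    then have "e 0 = 0" using xy by (simp add: e_def \<beta>_def J_def u0)
    then have "e s = 0" using C[of 0] C[OF s] by simp
    then have J: "exp (- \<beta> x y s) * (u y s - u x s) = (y - x) * J x y s"
      by (simp add: e_def)
    have "u y s - u x s = exp (\<beta> x y s) * (exp (- \<beta> x y s) * (u y s - u x s))"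
      by (simp add: exp_minus)
    then show ?thesis
      unfolding J by (simp add: P_def mult.left_commute)
  qed
  show ?thesis
  proof (rule that[of "\<lambda>x s. P x x s"])
    show "continuous_on ({0..} \<times> {0..}) (\<lambda>(x, s). P x x s)"
      using continuous_on_compose2[OF Pc, of "{0..} \<times> {0..}" "\<lambda>z. (snd z, fst z, fst z)"]
      by (force simp: split_beta image_subset_iff intro: continuous_intros)
    fix x s :: real assume x: "0 \<le> x" "0 \<le> s"
    have "continuous_on {0..} (\<lambda>y. (\<lambda>(\<sigma>, p). P (fst p) (snd p) \<sigma>) (s, x, y))"
      by (rule continuous_on_compose2[OF Pc]) (use x in \<open>auto intro!: continuous_intros\<close>)
    then have "continuous_on {0..} (\<lambda>y. P x y s)"
      by simp
    then have "continuous (at x within {0..}) (\<lambda>y. P x y s)"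
      using x by (simp add: continuous_on_eq_continuous_within)
    then show "((\<lambda>y. u y s) has_real_derivative P x x s) (at x within {0..})"
      using x inc by (intro DERIV_quotient_limit[where g="\<lambda>y. P x y s"]) auto
  qed
qed

section \<open>Mealy systems\<close>

lemma self_dynamicsD:
  assumes "self_dynamics f g r R q"
  shows "0 < r" "r < R" "0 < q" "q < r"
    and "\<And>a b. 0 < a \<Longrightarrow> 0 < b \<Longrightarrow> b \<le> r + q \<Longrightarrow> q \<le> f a b - b \<and> q \<le> g b a - b"
    and "\<And>a b. 0 < a \<Longrightarrow> R - q \<le> b \<Longrightarrow> f a b - b \<le> - q \<and> g b a - b \<le> - q"
    and "\<And>a b. 0 < a \<Longrightarrow> r \<le> b \<Longrightarrow> b \<le> R \<Longrightarrow> \<bar>f a b - b\<bar> \<le> R - r \<and> \<bar>g b a - b\<bar> \<le> R - r"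
  using assms unfolding self_dynamics_def by blast+

text \<open>The inward inequalities hold for every positive value of the other component. Hence
  positivity alone decouples the system, and each component is confined by scalar barriers in its
  own direction of evolution.\<close>

lemma Mealy_solution_bounds:
  assumes dyn: "self_dynamics f g r R q"
    and u0: "\<forall>x\<ge>0. u0 x \<in> {r + q..R - q}" and v0: "\<forall>s\<ge>0. v0 s \<in> {r + q..R - q}"
    and sol: "positive_Mealy_solution f g u0 v0 u v" and xs: "0 \<le> x" "0 \<le> s"
  shows "u x s \<in> {r + q..R - q} \<and> v x s \<in> {r + q..R - q}"
proof -
  note d = self_dynamicsD[OF dyn]
  have pos: "0 < u x s" "0 < v x s"
    and us: "(u x has_real_derivative (f (v x s) (u x s) - u x s)) (at s within {0..})"
    and vx: "((\<lambda>y. v y s) has_real_derivative (g (v x s) (u x s) - v x s)) (at x within {0..})"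
    and init: "u x 0 = u0 x" "v 0 s = v0 s" if "0 \<le> x" "0 \<le> s" for x s
    using sol that unfolding positive_Mealy_solution_def by blast+
  have low: "0 < f a b - b \<and> 0 < g b a - b" if "0 < a" "0 < b" "b \<le> r + q" for a b
    using d(5)[OF that] d(3) by linarith
  have high: "f a b - b < 0 \<and> g b a - b < 0" if "0 < a" "R - q \<le> b" for a b
    using d(6)[OF that] d(3) by linarith
  have init': "r + q \<le> u x 0" "u x 0 \<le> R - q" "r + q \<le> v 0 s" "v 0 s \<le> R - q"
    using init[OF xs] u0 v0 xs by auto
  have "r + q \<le> u x s" by (rule barrier_below[OF us]) (use xs init' pos low in auto)
  moreover have "u x s \<le> R - q" by (rule barrier_above[OF us]) (use xs init' pos high in auto)
  moreover have "r + q \<le> v x s" by (rule barrier_below[OF vx]) (use xs init' pos low in auto)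
  moreover have "v x s \<le> R - q" by (rule barrier_above[OF vx]) (use xs init' pos high in auto)
  ultimately show ?thesis by simp
qed

lemma bounded_C2E:
  assumes "bounded_C2 h"
  obtains h' where "\<And>x. 0 \<le> x \<Longrightarrow> (h has_real_derivative h' x) (at x within {0..})" "continuous_on {0..} h'"
proof -
  from assms obtain h' h'' where h: "\<And>x. 0 \<le> x \<Longrightarrow> (h has_real_derivative h' x) (at x within {0..})"
    and h': "\<And>x. 0 \<le> x \<Longrightarrow> (h' has_real_derivative h'' x) (at x within {0..})"
    unfolding bounded_C2_def by blast
  have "continuous_on {0..} h'"
    by (rule DERIV_continuous_on[OF h']) auto
  then show ?thesis using that h by blast
qed

lemma continuous_on_swap_quadrant:
  assumes "continuous_on (A \<times> A) (\<lambda>(x, s). w x s)"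
  shows "continuous_on (A \<times> A) (\<lambda>(s, x). w x s)"
proof -
  have "continuous_on (A \<times> A) (\<lambda>z. (\<lambda>(x, s). w x s) (prod.swap z))"
    by (rule continuous_on_compose2[OF assms]) (auto simp: prod.swap_def intro!: continuous_intros)
  then show ?thesis by (simp add: split_beta)
qed

theorem theorem1p9:
  fixes t r R q :: real
    and f g :: "real \<Rightarrow> real \<Rightarrow> real"
    and u0 v0 :: "real \<Rightarrow> real"
  assumes "t > 1"
    and "relatively_elementary t f" and "relatively_elementary t g"
    and "self_dynamics f g r R q"
    and "\<forall>x\<ge>0. u0 x \<in> {r + q..R - q}" and "bounded_C2 u0"
    and "\<forall>s\<ge>0. v0 s \<in> {r + q..R - q}" and "bounded_C2 v0"
  shows "(\<exists>u v. positive_Mealy_solution f g u0 v0 u v \<and>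
            (\<forall>x\<ge>0. \<forall>s\<ge>0. u x s \<in> {r + q..R - q} \<and> v x s \<in> {r + q..R - q})) \<and>
         (\<forall>u v u' v'.
            positive_Mealy_solution f g u0 v0 u v \<and> positive_Mealy_solution f g u0 v0 u' v' \<longrightarrow>
            (\<forall>x\<ge>0. \<forall>s\<ge>0. u x s = u' x s \<and> v x s = v' x s))"
proof -
  note d = self_dynamicsD[OF assms(4)]
  let ?I = "{r + q..R - q}"
  let ?Q = "{0..} \<times> {0..} :: (real \<times> real) set"
  \<comment> \<open>The value \<open>u0 0\<close> witnesses that the interval is nonempty; the
    truncation \<open>cl\<close> below relies on this.\<close>
  have ne: "r + q \<le> R - q" using assms(5) by force
  have I_pos: "?I \<times> ?I \<subseteq> {0<..} \<times> {0<..}" using d(1,3) by auto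
  \<comment> \<open>Both \<open>F\<close> and \<open>G\<close> take the evolving component as second
    coordinate, so that \<open>F\<close> is applied to (v, u) and \<open>G\<close> to (u, v). This
    makes the two equations interchangeable.\<close>
  define F where "F p = f (fst p) (snd p) - snd p" for p
  define G where "G p = g (snd p) (fst p) - snd p" for p
  have "divided_C1 ({0<..} \<times> {0<..}) F"
    unfolding F_def using relatively_elementary_imp_divided_C1[OF assms(2)] assms(1) by auto
  then have F: "divided_C1 (?I \<times> ?I) F" by (rule divided_C1_subset[OF _ I_pos])
  have "divided_C1 ({0<..} \<times> {0<..}) G"
    unfolding G_def using divided_C1_swap[OF relatively_elementary_imp_divided_C1[OF assms(3)]] assms(1)
    by (auto simp: product_swap)
  then have G: "divided_C1 (?I \<times> ?I) G" by (rule divided_C1_subset[OF _ I_pos])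
  have comp: "compact (?I \<times> ?I)" by (intro compact_Times compact_Icc)
  obtain L1 where "0 < L1"
    and L1: "\<And>p p'. p \<in> ?I \<times> ?I \<Longrightarrow> p' \<in> ?I \<times> ?I \<Longrightarrow> \<bar>F p' - F p\<bar> \<le> L1 * (\<bar>fst p' - fst p\<bar> + \<bar>snd p' - snd p\<bar>)"
    by (rule divided_C1_imp_Lipschitz[OF F comp]) blast
  obtain L2 where L2: "\<And>p p'. p \<in> ?I \<times> ?I \<Longrightarrow> p' \<in> ?I \<times> ?I \<Longrightarrow> \<bar>G p' - G p\<bar> \<le> L2 * (\<bar>fst p' - fst p\<bar> + \<bar>snd p' - snd p\<bar>)"
    by (rule divided_C1_imp_Lipschitz[OF G comp]) blast
  define L where "L = max L1 L2"
  have "0 < L" using \<open>0 < L1\<close> by (simp add: L_def)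
  have LF: "\<bar>F p' - F p\<bar> \<le> L * (\<bar>fst p' - fst p\<bar> + \<bar>snd p' - snd p\<bar>)"
    and LG: "\<bar>G p' - G p\<bar> \<le> L * (\<bar>fst p' - fst p\<bar> + \<bar>snd p' - snd p\<bar>)"
    if "p \<in> ?I \<times> ?I" "p' \<in> ?I \<times> ?I" for p p'
    by (rule order_trans[OF L1[OF that]] order_trans[OF L2[OF that]], rule mult_right_mono; simp add: L_def)+

  \<comment> \<open>The a priori bounds place both solutions in the square, where the Lipschitz
    estimates are available.\<close>
  have unique: "u x s = u' x s \<and> v x s = v' x s"
    if sol: "positive_Mealy_solution f g u0 v0 u v" "positive_Mealy_solution f g u0 v0 u' v'"
      and xs: "0 \<le> x" "0 \<le> s" for u v u' v' x s
    by (rule goursat_unique[where F=F and G=G and I="?I", OF \<open>0 < L\<close> LF LG bounded_closed_interval _ _ _ _ _ _ _ _ xs])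
       (use Mealy_solution_bounds[OF assms(4,5,7) sol(1)] Mealy_solution_bounds[OF assms(4,5,7) sol(2)]
          sol in \<open>auto simp: positive_Mealy_solution_def F_def G_def\<close>)

  \<comment> \<open>Truncation to \<open>?I\<close> makes the right-hand sides globally Lipschitz and bounded; the barriers show
    afterwards that the solution never feels it.\<close>
  define cl where "cl z = max (r + q) (min (R - q) z)" for z
  have cl_I: "cl z \<in> ?I" for z using ne by (auto simp: cl_def)
  have cl_id: "z \<in> ?I \<Longrightarrow> cl z = z" for z by (auto simp: cl_def)
  have cl_contr: "\<bar>cl z' - cl z\<bar> \<le> \<bar>z' - z\<bar>" for z z' by (auto simp: cl_def)
  define P where "P p = (cl (fst p), cl (snd p))" for p
  have P_I: "P p \<in> ?I \<times> ?I" for p using cl_I by (simp add: P_def)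
  have P_contr: "L * (\<bar>fst (P p') - fst (P p)\<bar> + \<bar>snd (P p') - snd (P p)\<bar>) \<le> L * (\<bar>fst p' - fst p\<bar> + \<bar>snd p' - snd p\<bar>)" for p p'
    unfolding P_def using \<open>0 < L\<close> by (intro mult_left_mono add_mono) (auto simp: cl_contr)
  \<comment> \<open>Since \<open>?I\<close> lies in [r, R], the third condition of the self-dynamics
    bounds the truncated right-hand sides.\<close>
  have FP: "\<bar>F (P p)\<bar> \<le> R - r" and GP: "\<bar>G (P p)\<bar> \<le> R - r" for p
    using d(7)[of "cl (fst p)" "cl (snd p)"] cl_I[of "fst p"] cl_I[of "snd p"] d(1,3)
    by (auto simp: F_def G_def P_def)

  obtain u0' where u0': "\<And>x. 0 \<le> x \<Longrightarrow> (u0 has_real_derivative u0' x) (at x within {0..})" and u0'c: "continuous_on {0..} u0'"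
    by (rule bounded_C2E[OF assms(6)]) blast
  obtain v0' where v0': "\<And>x. 0 \<le> x \<Longrightarrow> (v0 has_real_derivative v0' x) (at x within {0..})" and v0'c: "continuous_on {0..} v0'"
    by (rule bounded_C2E[OF assms(8)]) blast
  obtain u v where uc: "continuous_on UNIV (\<lambda>(x, s). u x s)" and vc: "continuous_on UNIV (\<lambda>(x, s). v x s)"
    and u: "\<And>x s. 0 \<le> x \<Longrightarrow> 0 \<le> s \<Longrightarrow> u x s = u0 x + s * segment_mean (\<lambda>\<sigma>. F (P (v x \<sigma>, u x \<sigma>))) 0 s"
    and v: "\<And>x s. 0 \<le> x \<Longrightarrow> 0 \<le> s \<Longrightarrow> v x s = v0 s + x * segment_mean (\<lambda>y. G (P (u y s, v y s))) 0 x"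
  proof (rule goursat_integral_solution[where F="\<lambda>p. F (P p)" and G="\<lambda>p. G (P p)" and L=L and M="R - r" and C=R and ?u0.0=u0 and ?v0.0=v0])
    show "continuous_on {0..} u0" "continuous_on {0..} v0"
      using u0' v0' by (auto intro: DERIV_continuous_on)
    show "\<bar>u0 x\<bar> \<le> R" "\<bar>v0 x\<bar> \<le> R" if "0 \<le> x" for x
      using assms(5,7) that d(1,3) by force+
  qed (use \<open>0 < L\<close> order_trans[OF LF[OF P_I P_I] P_contr] order_trans[OF LG[OF P_I P_I] P_contr] FP GP in blast)+

  have Pc: "continuous_on UNIV P"
    unfolding P_def cl_def by (intro continuous_intros)
  have FPc: "continuous_on UNIV (\<lambda>z. F (P z))" and GPc: "continuous_on UNIV (\<lambda>z. G (P z))"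
    using continuous_on_compose2[OF divided_C1_imp_continuous_on[OF F] Pc]
      continuous_on_compose2[OF divided_C1_imp_continuous_on[OF G] Pc] P_I by (auto simp: image_subset_iff)
  have line: "continuous_on T (\<lambda>\<sigma>. w x \<sigma>)" "continuous_on T (\<lambda>y. w y s)"
    if "continuous_on UNIV (\<lambda>(x, s). w x s)" for T x s and w :: "real \<Rightarrow> real \<Rightarrow> real"
    using continuous_on_compose2[OF that, of T "\<lambda>\<sigma>. (x, \<sigma>)"] continuous_on_compose2[OF that, of T "\<lambda>y. (y, s)"]
    by (force intro: continuous_intros)+
  have us: "(u x has_real_derivative F (P (v x s, u x s))) (at s within {0..})" if "0 \<le> x" "0 \<le> s" for x s
  proof -
    have "((\<lambda>s. u0 x + s * segment_mean (\<lambda>\<sigma>. F (P (v x \<sigma>, u x \<sigma>))) 0 s) has_real_derivative 0 + F (P (v x s, u x s))) (at s within {0..})"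
      by (intro DERIV_add DERIV_const has_real_derivative_segment_mean
            continuous_on_compose2[OF FPc] continuous_on_Pair line uc vc that subset_UNIV)
    then show ?thesis
      using that u by (auto elim!: has_field_derivative_transform_within[OF _ zero_less_one])
  qed
  have vx: "((\<lambda>y. v y s) has_real_derivative G (P (u x s, v x s))) (at x within {0..})" if "0 \<le> x" "0 \<le> s" for x s
  proof -
    have "((\<lambda>x. v0 s + x * segment_mean (\<lambda>y. G (P (u y s, v y s))) 0 x) has_real_derivative 0 + G (P (u x s, v x s))) (at x within {0..})"
      by (intro DERIV_add DERIV_const has_real_derivative_segment_mean
            continuous_on_compose2[OF GPc] continuous_on_Pair line uc vc that subset_UNIV)
    then show ?thesis
      using that v by (auto elim!: has_field_derivative_transform_within[OF _ zero_less_one])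
  qed
  have init: "u x 0 = u0 x" "v 0 s = v0 s" if "0 \<le> x" "0 \<le> s" for x s
    using u[of x 0] v[of 0 s] that by simp_all
  have cl_pos: "0 < cl a" for a using cl_I[of a] d(1,3) by auto
  \<comment> \<open>Positivity of the constructed functions is not yet known, so \<open>b\<close>
    may even be negative. Truncation moves it to \<open>r + q\<close>, where the inward inequality
    holds, and also makes the other argument positive.\<close>
  have clamped: "0 < F (P (a, b)) \<and> 0 < G (P (a, b))" if "b \<le> r + q" for a b
  proof -
    have "cl b = r + q" using that ne by (auto simp: cl_def)
    then show ?thesis using d(5)[OF cl_pos, of "r + q" a] d(1,3) by (auto simp: F_def G_def P_def)
  qed
  have clamped': "F (P (a, b)) < 0 \<and> G (P (a, b)) < 0" if "R - q \<le> b" for a b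
  proof -
    have "cl b = R - q" using that ne by (auto simp: cl_def)
    then show ?thesis using d(6)[OF cl_pos, of "R - q" a] d(1,3) by (auto simp: F_def G_def P_def)
  qed
  have bds: "u x s \<in> ?I" "v x s \<in> ?I" if xs: "0 \<le> x" "0 \<le> s" for x s
  proof -
    have "r + q \<le> u x s" by (rule barrier_below[OF us]) (use xs init assms(5) clamped in auto)
    moreover have "u x s \<le> R - q" by (rule barrier_above[OF us]) (use xs init assms(5) clamped' in auto)
    ultimately show "u x s \<in> ?I" by simp
    have "r + q \<le> v x s"
      by (rule barrier_below[OF vx]) (use xs init assms(7) clamped in auto)
    moreover have "v x s \<le> R - q"
      by (rule barrier_above[OF vx]) (use xs init assms(7) clamped' in auto)
    ultimately show "v x s \<in> ?I" by simp
  qed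
  have P_id: "P (v x s, u x s) = (v x s, u x s)" "P (u x s, v x s) = (u x s, v x s)" if "0 \<le> x" "0 \<le> s" for x s
    using bds[OF that] by (simp_all add: P_def cl_id)
  have us': "(u x has_real_derivative F (v x s, u x s)) (at s within {0..})"
    and vx': "((\<lambda>y. v y s) has_real_derivative G (u x s, v x s)) (at x within {0..})" if "0 \<le> x" "0 \<le> s" for x s
    using us[OF that] vx[OF that] by (simp_all add: P_id[OF that])
  have quad: "continuous_on ?Q (\<lambda>(x, s). u x s)" "continuous_on ?Q (\<lambda>(x, s). v x s)"
    using uc vc by (auto intro: continuous_on_subset)
  \<comment> \<open>Continuity is inherited from the truncated right-hand sides, which coincide with
    the original ones along the solution.\<close>
  have usc: "continuous_on ?Q (\<lambda>(x, s). F (v x s, u x s))" and vxc: "continuous_on ?Q (\<lambda>(x, s). G (u x s, v x s))"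
    by (rule continuous_on_eq[OF continuous_on_compose2[OF FPc continuous_on_Pair[OF quad(2,1)[unfolded split_beta]] subset_UNIV]]
          continuous_on_eq[OF continuous_on_compose2[OF GPc continuous_on_Pair[OF quad[unfolded split_beta]] subset_UNIV]];
        auto simp: P_id)+
  obtain ux where ux: "continuous_on ?Q (\<lambda>(x, s). ux x s)"
    "\<And>x s. 0 \<le> x \<Longrightarrow> 0 \<le> s \<Longrightarrow> ((\<lambda>y. u y s) has_real_derivative ux x s) (at x within {0..})"
    by (rule parameter_derivative[where u=u and v=v and w="\<lambda>x s. G (u x s, v x s)", OF F quad _ us' vx' vxc u0' u0'c init(1)])
       (use bds in auto)
  \<comment> \<open>Now \<open>x\<close> is the evolution variable and \<open>s\<close> the
    parameter; the derivative known beforehand is that of \<open>u\<close> in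
    \<open>s\<close>.\<close>
  obtain vs where vs: "continuous_on ?Q (\<lambda>(s, x). vs s x)"
    "\<And>s x. 0 \<le> s \<Longrightarrow> 0 \<le> x \<Longrightarrow> (v x has_real_derivative vs s x) (at s within {0..})"
    by (rule parameter_derivative[where u="\<lambda>s x. v x s" and v="\<lambda>s x. u x s" and w="\<lambda>s x. F (v x s, u x s)",
          OF G quad(2,1)[THEN continuous_on_swap_quadrant] _ vx' us' usc[THEN continuous_on_swap_quadrant] v0' v0'c init(2)])
       (use bds in auto)
  have "C1_quadrant u"
    unfolding C1_quadrant_def
    by (intro exI[of _ ux] exI[of _ "\<lambda>x s. F (v x s, u x s)"] conjI allI impI ux us' usc)
  moreover have "C1_quadrant v"
    unfolding C1_quadrant_def
    by (intro exI[of _ "\<lambda>x s. G (u x s, v x s)"] exI[of _ "\<lambda>x s. vs s x"] conjI allI impI vs vx' vxc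
          continuous_on_swap_quadrant[OF vs(1)])
  moreover have "0 < u x s" "0 < v x s" if "0 \<le> x" "0 \<le> s" for x s
    using bds[OF that] d(1,3) by auto
  moreover note us'[unfolded F_def fst_conv snd_conv] vx'[unfolded G_def fst_conv snd_conv] init
  ultimately have "positive_Mealy_solution f g u0 v0 u v"
    unfolding positive_Mealy_solution_def by simp
  then show ?thesis using bds unique by blast
qed

end
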